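(* Let $d\ge 2$ and let $E$ be a POVM with finitely many outcomes on $\mathbb{C}^d\otimes\mathbb{C}^d$ which determines whether a state is PPT or NPT, i.e., there do not exist a PPT state $\varrho_1$ and an NPT state $\varrho_2$ on $\mathbb{C}^d\otimes\mathbb{C}^d$ with $\mathrm{tr}[\varrho_1E_j]=\mathrm{tr}[\varrho_2E_j]$ for all outcomes $j$. Then $E$ is informationally complete.
   Context: A state on $\mathbb{C}^d\otimes\mathbb{C}^d$ is a positive semidefinite operator of trace one. A POVM with finitely many outcomes is a finite family $(E_j)$ of positive semidefinite operators on $\mathbb{C}^d\otimes\mathbb{C}^d$ with $\sum_j E_j=\mathbb{1}$; measuring it in the state $\varrho$ gives outcome $j$ with probability $\mathrm{tr}[\varrho E_j]$. Put $\mathcal{X}_E=\{\Delta \text{ Hermitian} \mid \mathrm{tr}[\Delta E_j]=0 \text{ for all } j\}$ (such $\Delta$ are automatically traceless). $E$ is informationally complete if $\mathcal{X}_E=\{0\}$; equivalently, any two distinct states yield different outcome probabilities. The partial transpose $X\mapsto X^\tau$ with respect to the second factor is the linear map determined by $(Y\otimes Z)^\tau=Y\otimes Z^{T}$, with $T$ the transpose in the computational basis. A state $\varrho$ is PPT if $\varrho^\tau$ is positive semidefinite, and NPT if $\varrho^\tau$ has a negative eigenvalue. *)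

theory Defs
  imports "HOL-Analysis.Analysis"
begin

(* The basis of C^d is indexed by a finite type 'd with CARD('d) = d, so that C^d (x) C^d has the
   basis 'd * 'd; operators are identified with their matrices in the computational basis. *)
type_synonym 'd bipartite_op = "complex^('d \<times> 'd)^('d \<times> 'd)"

definition adjoint_mat :: "complex^'m^'n \<Rightarrow> complex^'n^'m" where
  "adjoint_mat A = (\<chi> i j. cnj (A $ j $ i))"

definition hermitian_mat :: "complex^'n^'n \<Rightarrow> bool" where
  "hermitian_mat A \<longleftrightarrow> adjoint_mat A = A"

(* antilinear in the first argument *)
definition cinner_vec :: "complex^'n \<Rightarrow> complex^'n \<Rightarrow> complex" where
  "cinner_vec v w = (\<Sum>i\<in>UNIV. cnj (v $ i) * w $ i)"

(* For Hermitian A the number cinner_vec v (A *v v) is real, so taking Re loses nothing. *)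
definition psd_mat :: "complex^'n^'n \<Rightarrow> bool" where
  "psd_mat A \<longleftrightarrow> hermitian_mat A \<and> (\<forall>v. 0 \<le> Re (cinner_vec v (A *v v)))"

definition eigenvalue_mat :: "complex^'n^'n \<Rightarrow> complex \<Rightarrow> bool" where
  "eigenvalue_mat A c \<longleftrightarrow> (\<exists>v. v \<noteq> 0 \<and> A *v v = c *s v)"

definition state :: "('d::finite) bipartite_op \<Rightarrow> bool" where
  "state \<rho> \<longleftrightarrow> psd_mat \<rho> \<and> trace \<rho> = 1"

definition povm :: "'o set \<Rightarrow> ('o \<Rightarrow> ('d::finite) bipartite_op) \<Rightarrow> bool" where
  "povm J E \<longleftrightarrow> finite J \<and> (\<forall>j\<in>J. psd_mat (E j)) \<and> (\<Sum>j\<in>J. E j) = mat 1"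

(* tr[rho E_j]; complex-valued, but real for Hermitian arguments *)
definition outcome_prob :: "('o \<Rightarrow> ('d::finite) bipartite_op) \<Rightarrow> 'd bipartite_op \<Rightarrow> 'o \<Rightarrow> complex" where
  "outcome_prob E \<rho> j = trace (\<rho> ** E j)"

definition undetected_perturbations ::
    "'o set \<Rightarrow> ('o \<Rightarrow> ('d::finite) bipartite_op) \<Rightarrow> 'd bipartite_op set" where
  "undetected_perturbations J E = {\<Delta>. hermitian_mat \<Delta> \<and> (\<forall>j\<in>J. trace (\<Delta> ** E j) = 0)}"

definition informationally_complete :: "'o set \<Rightarrow> ('o \<Rightarrow> ('d::finite) bipartite_op) \<Rightarrow> bool" where
  "informationally_complete J E \<longleftrightarrow> undetected_perturbations J E = {0}"

definition tensor_op :: "complex^'d^'d \<Rightarrow> complex^'d^'d \<Rightarrow> ('d::finite) bipartite_op" where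
  "tensor_op Y Z = (\<chi> p q. Y $ fst p $ fst q * Z $ snd p $ snd q)"

(* Given by matrix entries; partial_transpose_unique below shows that it is the linear map
   determined by its values tensor_op Y (transpose Z) on the product operators tensor_op Y Z. *)
definition partial_transpose :: "('d::finite) bipartite_op \<Rightarrow> 'd bipartite_op" where
  "partial_transpose X = (\<chi> p q. X $ (fst p, snd q) $ (fst q, snd p))"

definition ppt :: "('d::finite) bipartite_op \<Rightarrow> bool" where
  "ppt \<rho> \<longleftrightarrow> psd_mat (partial_transpose \<rho>)"

definition npt :: "('d::finite) bipartite_op \<Rightarrow> bool" where
  "npt \<rho> \<longleftrightarrow> (\<exists>c::real. c < 0 \<and> eigenvalue_mat (partial_transpose \<rho>) (complex_of_real c))"

definition determines_ppt_npt :: "'o set \<Rightarrow> ('o \<Rightarrow> ('d::finite) bipartite_op) \<Rightarrow> bool" where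
  "determines_ppt_npt J E \<longleftrightarrow>
     \<not> (\<exists>\<rho>\<^sub>1 \<rho>\<^sub>2. state \<rho>\<^sub>1 \<and> ppt \<rho>\<^sub>1 \<and> state \<rho>\<^sub>2 \<and> npt \<rho>\<^sub>2 \<and>
           (\<forall>j\<in>J. outcome_prob E \<rho>\<^sub>1 j = outcome_prob E \<rho>\<^sub>2 j))"

definition cscale :: "complex \<Rightarrow> complex^'m^'n \<Rightarrow> complex^'m^'n"  (infixr "*\<^sub>m" 75) where
  "c *\<^sub>m A = (\<chi> i j. c * A $ i $ j)"

lemma partial_transpose_add: "partial_transpose (X + Y) = partial_transpose X + partial_transpose Y"
  by (simp add: partial_transpose_def vec_eq_iff)

lemma partial_transpose_scale: "partial_transpose (c *\<^sub>m X) = c *\<^sub>m partial_transpose X"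
  by (simp add: cscale_def partial_transpose_def vec_eq_iff)

lemma partial_transpose_tensor: "partial_transpose (tensor_op Y Z) = tensor_op Y (transpose Z)"
  by (simp add: partial_transpose_def tensor_op_def transpose_def vec_eq_iff)

lemma partial_transpose_unique:
  fixes f :: "('d::finite) bipartite_op \<Rightarrow> 'd bipartite_op"
  assumes add: "\<And>X Y. f (X + Y) = f X + f Y"
    and scale: "\<And>c X. f (c *\<^sub>m X) = c *\<^sub>m f X"
    and tensor: "\<And>Y Z. f (tensor_op Y Z) = tensor_op Y (transpose Z)"
  shows "f = partial_transpose"
proof
  fix X :: "'d bipartite_op"
  define U :: "'d \<Rightarrow> 'd \<Rightarrow> complex^'d^'d"
    where "U = (\<lambda>i j. \<chi> a b. if a = i \<and> b = j then 1 else 0)"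
  define B where "B = (\<lambda>(p, q). tensor_op (U (fst p) (fst q)) (U (snd p) (snd q)))"
  have B: "B (p, q) $ a $ b = (if p = a \<and> q = b then 1 else 0)" for p q a b
    by (auto simp: B_def U_def tensor_op_def prod_eq_iff)
  have sum_fun: "g (\<Sum>r\<in>R. h r) = (\<Sum>r\<in>R. g (h r))"
    if "finite R" "\<And>X Y. g (X + Y) = g X + g Y"
    for g :: "'d bipartite_op \<Rightarrow> 'd bipartite_op" and h :: "('d \<times> 'd) \<times> ('d \<times> 'd) \<Rightarrow> _" and R
  proof -
    have "g 0 = 0" using that(2)[of 0 0] by simp
    with that show ?thesis by (induction R rule: finite_induct) simp_all
  qed
  have X: "X = (\<Sum>r\<in>UNIV. (X $ fst r $ snd r) *\<^sub>m B r)"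
  proof -
    have "(\<Sum>r\<in>UNIV. (X $ fst r $ snd r) *\<^sub>m B r) $ a $ b = X $ a $ b" for a b
    proof -
      have "(\<Sum>r\<in>UNIV. (X $ fst r $ snd r) *\<^sub>m B r) $ a $ b
              = (\<Sum>r\<in>UNIV. if r = (a, b) then X $ fst r $ snd r else 0)"
        by (simp only: sum_component) (rule sum.cong, auto simp: B cscale_def split: if_splits)
      then show ?thesis by simp
    qed
    then show ?thesis by (simp add: vec_eq_iff)
  qed
  have fB: "f (B r) = partial_transpose (B r)" for r
    by (simp add: B_def case_prod_unfold tensor partial_transpose_tensor)
  show "f X = partial_transpose X"
    by (subst (1 2) X)
      (simp add: sum_fun[of UNIV f] sum_fun[of UNIV partial_transpose] add scale fB
        partial_transpose_add partial_transpose_scale)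
qed

end

theory Submission
  imports Defs
begin

text \<open>
  Let \<open>\<Delta>\<close> be a nonzero undetected perturbation. The quadratic form of its partial transpose is
  nonzero at some vector, and, since product vectors are nowhere dense, at some entangled \<open>v\<close>.
  For entangled \<open>v\<close> the operator \<open>\<parallel>v\<parallel>\<^sup>2 1 - (vv\<^sup>*)\<^sup>\<tau>\<close> is positive definite, so it
  stays positive under small perturbations by multiples of \<open>\<Delta>\<close>; its partial transpose
  \<open>\<parallel>v\<parallel>\<^sup>2 1 - vv\<^sup>*\<close> is positive semidefinite with \<open>v\<close> in the kernel, so it
  loses positivity under an arbitrarily small multiple of \<open>\<Delta>\<close> of the right sign.
\<close>

section \<open>Quadratic forms of Hermitian matrices\<close>

text \<open>Makes the library theory of real inner product spaces available: from here on quadratic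
  forms are real numbers written with \<open>\<bullet>\<close>.\<close>

lemma Re_cinner_vec: "Re (cinner_vec v w) = v \<bullet> w"
  by (simp add: cinner_vec_def inner_vec_def inner_complex_def)

lemma psd_mat_iff: "psd_mat A \<longleftrightarrow> hermitian_mat A \<and> (\<forall>v. 0 \<le> v \<bullet> (A *v v))"
  by (simp add: psd_mat_def Re_cinner_vec)

lemma hermitian_mat_iff: "hermitian_mat A \<longleftrightarrow> (\<forall>i j. cnj (A $ j $ i) = A $ i $ j)"
  by (simp add: hermitian_mat_def adjoint_mat_def vec_eq_iff)

lemma hermitian_mat_add: "hermitian_mat A \<Longrightarrow> hermitian_mat B \<Longrightarrow> hermitian_mat (A + B)"
  by (simp add: hermitian_mat_iff)

lemma hermitian_mat_diff: "hermitian_mat A \<Longrightarrow> hermitian_mat B \<Longrightarrow> hermitian_mat (A - B)"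
  by (simp add: hermitian_mat_iff)

lemma hermitian_mat_scaleR: "hermitian_mat A \<Longrightarrow> hermitian_mat (r *\<^sub>R A)"
  by (simp add: hermitian_mat_iff)

lemma hermitian_mat_one: "hermitian_mat (mat 1)"
  by (simp add: hermitian_mat_iff mat_def)

lemma matrix_vector_mult_scaleR_left: "(r *\<^sub>R (A :: complex^'n^'m)) *v x = r *\<^sub>R (A *v x)"
  by (simp add: vec_eq_iff matrix_vector_mult_def scaleR_sum_right)

lemma matrix_vector_mult_scaleR_right: "(A :: complex^'n^'m) *v (r *\<^sub>R x) = r *\<^sub>R (A *v x)"
  by (simp add: vec_eq_iff matrix_vector_mult_def scaleR_sum_right)

lemma continuous_on_matrix_vector_mult [continuous_intros]:
  assumes "continuous_on S f"
  shows "continuous_on S (\<lambda>x. (A :: complex^'n^'m) *v f x)"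
  unfolding matrix_vector_mult_def
  by (intro continuous_intros assms)

lemma hermitian_mat_inner:
  fixes A :: "complex^'n^'n"
  assumes "hermitian_mat A"
  shows "(A *v x) \<bullet> y = x \<bullet> (A *v y)"
proof -
  have "cinner_vec (A *v x) y = (\<Sum>i\<in>UNIV. \<Sum>j\<in>UNIV. cnj (A $ i $ j) * cnj (x $ j) * y $ i)"
    by (simp add: cinner_vec_def matrix_vector_mult_def sum_distrib_right)
  also have "\<dots> = (\<Sum>j\<in>UNIV. \<Sum>i\<in>UNIV. A $ j $ i * cnj (x $ j) * y $ i)"
    using assms by (subst sum.swap) (simp add: hermitian_mat_iff)
  also have "\<dots> = cinner_vec x (A *v y)"
    by (simp add: cinner_vec_def matrix_vector_mult_def sum_distrib_left mult_ac)
  finally show ?thesis by (metis Re_cinner_vec)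
qed

lemma qform_homogeneous:
  "(r *\<^sub>R x) \<bullet> ((A :: complex^'n^'n) *v (r *\<^sub>R x)) = r\<^sup>2 * (x \<bullet> (A *v x))"
  by (simp add: matrix_vector_mult_scaleR_right power2_eq_square)

text \<open>First variation at a minimum: moving from \<open>v\<close> to
  \<open>v - t *\<^sub>R (C *v v)\<close> changes the form by a negative term linear in
  \<open>t\<close> plus a quadratic one, so for small \<open>t\<close> the form would become
  negative unless \<open>C *v v\<close> vanishes.\<close>

lemma psd_mat_kernel:
  assumes psd: "psd_mat C" and zero: "v \<bullet> (C *v v) = 0"
  shows "C *v v = 0"
proof (rule ccontr)
  assume nz: "C *v v \<noteq> 0"
  define w where "w = C *v v"
  define q where "q = w \<bullet> (C *v w)"
  have herm: "hermitian_mat C" and nonneg: "0 \<le> x \<bullet> (C *v x)" for x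
    using psd by (auto simp: psd_mat_iff)
  have "0 < w \<bullet> w" and "0 \<le> q"
    using nz nonneg by (auto simp: w_def q_def)
  \<comment> \<open>Small enough that the quadratic term cannot outweigh the linear one; the added 1
    keeps the quotient defined when \<open>q = 0\<close>.\<close>
  define t where "t = (w \<bullet> w) / (q + 1)"
  have "t > 0" using \<open>0 < w \<bullet> w\<close> \<open>0 \<le> q\<close> by (simp add: t_def)
  have vw: "v \<bullet> (C *v w) = w \<bullet> w"
    using hermitian_mat_inner[OF herm, of v w] by (simp add: w_def)
  have "0 \<le> (v - t *\<^sub>R w) \<bullet> (C *v (v - t *\<^sub>R w))" by (rule nonneg)
  also have "\<dots> = t * (t * q - 2 * (w \<bullet> w))"
    using zero vw
    by (simp add: matrix_vector_mult_diff_distrib matrix_vector_mult_scaleR_right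
        inner_diff_left inner_diff_right q_def w_def[symmetric] algebra_simps)
  finally have "2 * (w \<bullet> w) \<le> t * q"
    using \<open>t > 0\<close> by (simp add: zero_le_mult_iff)
  moreover have "t * q \<le> w \<bullet> w"
    using \<open>0 \<le> q\<close> \<open>0 < w \<bullet> w\<close> by (simp add: t_def field_simps)
  ultimately show False using \<open>0 < w \<bullet> w\<close> by linarith
qed

text \<open>If the form vanished identically, \<open>B\<close> would be positive semidefinite with
  every vector in its kernel, hence zero. This replaces a polarization argument.\<close>

lemma hermitian_mat_qform_nonzero:
  assumes "hermitian_mat (B :: complex^'n^'n)" "B \<noteq> 0"
  obtains v where "v \<bullet> (B *v v) \<noteq> 0"
proof -
  have "\<exists>v. v \<bullet> (B *v v) \<noteq> 0"
  proof (rule ccontr)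
    assume "\<not> (\<exists>v. v \<bullet> (B *v v) \<noteq> 0)"
    then have "B *v v = 0 *v v" for v
      using psd_mat_kernel[of B v] assms(1) by (simp add: psd_mat_iff)
    then show False using assms(2) by (metis matrix_eq)
  qed
  with that show thesis by blast
qed

text \<open>The minimum \<open>c\<close> of the form over the compact unit sphere is an eigenvalue,
  since \<open>B - c *\<^sub>R mat 1\<close> is positive semidefinite and has the minimizer in its
  kernel. Links \<open>npt\<close>, which speaks of eigenvalues, to negative values of the
  form.\<close>

lemma hermitian_mat_negative_eigenvalue:
  fixes B :: "complex^'n^'n"
  assumes herm: "hermitian_mat B" and neg: "v \<bullet> (B *v v) < 0"
  obtains c :: real where "c < 0" "eigenvalue_mat B (complex_of_real c)"
proof -
  have "v \<noteq> 0" using neg by auto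
  define u where "u = (1 / norm v) *\<^sub>R v"
  have u: "norm u = 1" using \<open>v \<noteq> 0\<close> by (simp add: u_def)
  have "u \<bullet> (B *v u) < 0"
    unfolding u_def qform_homogeneous using neg \<open>v \<noteq> 0\<close> by (intro mult_pos_neg) auto
  have "\<exists>x\<in>sphere 0 1. \<forall>y\<in>sphere 0 1. x \<bullet> (B *v x) \<le> y \<bullet> (B *v y)"
    using u by (intro continuous_attains_inf continuous_intros) auto
  then obtain x where x: "norm x = 1" and
    min: "\<And>y. norm y = 1 \<Longrightarrow> x \<bullet> (B *v x) \<le> y \<bullet> (B *v y)" by auto
  define c where "c = x \<bullet> (B *v x)"
  have "c < 0" using min[OF u] \<open>u \<bullet> (B *v u) < 0\<close> by (simp add: c_def)
  define C where "C = B - c *\<^sub>R mat 1"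
  have C: "C *v y = B *v y - c *\<^sub>R y" for y
    by (simp add: C_def matrix_vector_mult_diff_rdistrib matrix_vector_mult_scaleR_left)
  have "0 \<le> y \<bullet> (C *v y)" for y
  proof (cases "y = 0")
    case False
    have "c \<le> ((1 / norm y) *\<^sub>R y) \<bullet> (B *v ((1 / norm y) *\<^sub>R y))"
      unfolding c_def by (rule min) (use False in simp)
    then have "c \<le> (1 / norm y)\<^sup>2 * (y \<bullet> (B *v y))"
      by (simp only: qform_homogeneous)
    then have "c * (norm y)\<^sup>2 \<le> y \<bullet> (B *v y)"
      using False by (simp add: field_simps)
    then show ?thesis
      by (simp add: C inner_diff_right power2_norm_eq_inner)
  qed simp
  moreover have "hermitian_mat C"
    unfolding C_def by (intro hermitian_mat_diff hermitian_mat_scaleR hermitian_mat_one herm)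
  ultimately have "psd_mat C" by (simp add: psd_mat_iff)
  moreover have "x \<bullet> (C *v x) = 0"
    using x by (simp add: C c_def inner_diff_right norm_eq_1)
  ultimately have "C *v x = 0" by (rule psd_mat_kernel)
  then have "B *v x = complex_of_real c *s x"
    by (simp add: C vec_eq_iff scaleR_conv_of_real[where 'a = complex])
  moreover have "x \<noteq> 0" using x by auto
  ultimately have "eigenvalue_mat B (complex_of_real c)"
    unfolding eigenvalue_mat_def by blast
  with \<open>c < 0\<close> that show thesis by blast
qed

text \<open>By compactness of the unit sphere the form of \<open>A\<close> has a positive minimum
  \<open>m\<close> there and that of \<open>D\<close> is bounded by some \<open>K\<close>;
  homogeneity extends the estimate to all vectors.\<close>

lemma positive_definite_perturb:
  fixes A D :: "complex^'n^'n"
  assumes "hermitian_mat A" "hermitian_mat D"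
    and pos: "\<And>w. w \<noteq> 0 \<Longrightarrow> 0 < w \<bullet> (A *v w)"
  obtains e where "e > 0" "\<forall>s. \<bar>s\<bar> \<le> e \<longrightarrow> psd_mat (A + s *\<^sub>R D)"
proof -
  have ne: "sphere (0 :: complex^'n) 1 \<noteq> {}"
    using vector_choose_size[of 1] by fastforce
  have "\<exists>x\<in>sphere 0 1. \<forall>y\<in>sphere 0 1. x \<bullet> (A *v x) \<le> y \<bullet> (A *v y)"
    using ne by (intro continuous_attains_inf continuous_intros) auto
  then obtain x where x: "norm x = 1" and
    min: "\<And>y. norm y = 1 \<Longrightarrow> x \<bullet> (A *v x) \<le> y \<bullet> (A *v y)" by auto
  have "\<exists>x\<in>sphere 0 1. \<forall>y\<in>sphere 0 1. \<bar>y \<bullet> (D *v y)\<bar> \<le> \<bar>x \<bullet> (D *v x)\<bar>"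
    using ne by (intro continuous_attains_sup continuous_intros) auto
  then obtain z where
    max: "\<And>y. norm y = 1 \<Longrightarrow> \<bar>y \<bullet> (D *v y)\<bar> \<le> \<bar>z \<bullet> (D *v z)\<bar>"
    unfolding Ball_def mem_sphere_0 by blast
  define m where "m = x \<bullet> (A *v x)"
  define K where "K = \<bar>z \<bullet> (D *v z)\<bar>"
  have "m > 0" unfolding m_def by (rule pos) (use x in auto)
  have "K \<ge> 0" by (simp add: K_def)
  \<comment> \<open>Chosen so that \<open>e * K \<le> m\<close>; the added 1 covers
    \<open>K = 0\<close>.\<close>
  define e where "e = m / (K + 1)"
  have "e > 0" using \<open>m > 0\<close> \<open>K \<ge> 0\<close> by (simp add: e_def)
  moreover have "psd_mat (A + s *\<^sub>R D)" if s: "\<bar>s\<bar> \<le> e" for s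
  proof -
    have unit: "0 \<le> y \<bullet> ((A + s *\<^sub>R D) *v y)" if y: "norm y = 1" for y
    proof -
      have "\<bar>s * (y \<bullet> (D *v y))\<bar> \<le> e * K"
        unfolding abs_mult using s max[OF y] by (intro mult_mono) (auto simp: K_def)
      also have "\<dots> \<le> m" using \<open>m > 0\<close> \<open>K \<ge> 0\<close> by (simp add: e_def field_simps)
      also have "\<dots> \<le> y \<bullet> (A *v y)" using min[OF y] by (simp add: m_def)
      finally show ?thesis
        by (simp add: matrix_vector_mult_add_rdistrib matrix_vector_mult_scaleR_left
            inner_add_right)
    qed
    have "0 \<le> y \<bullet> ((A + s *\<^sub>R D) *v y)" for y
    proof (cases "y = 0")
      case False
      have "0 \<le> ((1 / norm y) *\<^sub>R y) \<bullet> ((A + s *\<^sub>R D) *v ((1 / norm y) *\<^sub>R y))"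
        by (rule unit) (use False in simp)
      then have "0 \<le> (1 / norm y)\<^sup>2 * (y \<bullet> ((A + s *\<^sub>R D) *v y))"
        by (simp only: qform_homogeneous)
      then show ?thesis using False by (simp add: zero_le_mult_iff)
    qed simp
    with assms(1,2) show ?thesis
      by (simp add: psd_mat_iff hermitian_mat_add hermitian_mat_scaleR)
  qed
  ultimately show thesis using that by blast
qed

section \<open>The complex Cauchy--Schwarz inequality\<close>

text \<open>Rotating \<open>y\<close> by a suitable phase makes the complex inner product real and
  nonnegative, which reduces the complex Cauchy-Schwarz inequality and its equality case to the real
  ones.\<close>

lemma cinner_vec_phase:
  obtains u where "norm u = 1" "norm (cinner_vec x y) = x \<bullet> (u *s y)"
proof -
  define c where "c = cinner_vec x y"
  define u where "u = (if c = 0 then 1 else cnj c / norm c)"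
  have "norm u = 1" by (simp add: u_def norm_divide)
  moreover have "u * c = norm c"
    using complex_norm_square[of c] by (simp add: u_def power2_eq_square field_simps)
  moreover have "x \<bullet> (u *s y) = Re (u * c)"
    unfolding Re_cinner_vec[symmetric]
    by (simp add: cinner_vec_def c_def sum_distrib_left mult_ac)
  ultimately show thesis using that[of u] by (simp add: c_def)
qed

lemma norm_vector_smult_unit: "norm u = 1 \<Longrightarrow> norm (u *s (y :: complex^'n)) = norm y"
  by (simp add: norm_vec_def norm_mult L2_set_def)

lemma norm_cinner_vec_le: "norm (cinner_vec x y) \<le> norm x * norm y"
proof -
  obtain u where "norm u = 1" "norm (cinner_vec x y) = x \<bullet> (u *s y)"
    by (rule cinner_vec_phase)
  then show ?thesis
    using norm_cauchy_schwarz[of x "u *s y"] by (simp add: norm_vector_smult_unit)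
qed

text \<open>Equality in the real inequality for \<open>x\<close> and the rotated \<open>y\<close>
  makes the two vectors parallel, and then all their 2-by-2 minors vanish.\<close>

lemma norm_cinner_vec_less:
  assumes "x $ i * y $ j \<noteq> x $ j * y $ i"
  shows "norm (cinner_vec x y) < norm x * norm y"
proof -
  obtain u where u: "norm u = 1" and eq: "norm (cinner_vec x y) = x \<bullet> (u *s y)"
    by (rule cinner_vec_phase)
  have "norm (cinner_vec x y) \<noteq> norm x * norm y"
  proof
    assume "norm (cinner_vec x y) = norm x * norm y"
    then have "norm x *\<^sub>R (u *s y) = norm y *\<^sub>R x"
      using u eq by (metis norm_cauchy_schwarz_eq norm_vector_smult_unit)
    then have "norm x *\<^sub>R (u * y $ k) = norm y *\<^sub>R x $ k" for k
      by (metis vector_scaleR_component vector_smult_component)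
    then have par: "norm x * (u * y $ k) = norm y * x $ k" for k
      by (simp only: scaleR_conv_of_real)
    \<comment> \<open>The intermediate product is symmetric in \<open>i\<close> and
      \<open>j\<close>, so the minor times \<open>norm y\<close> is zero.\<close>
    have "norm y * (x $ i * y $ j) = norm x * u * y $ i * y $ j"
      using par[of i] by (simp add: mult_ac)
    also have "\<dots> = norm y * (x $ j * y $ i)"
      using par[of j] by (simp add: mult_ac)
    finally have "y = 0" using assms by simp
    with assms show False by simp
  qed
  with norm_cinner_vec_le[of x y] show ?thesis by linarith
qed

section \<open>Partial transposes of rank one projections\<close>

text \<open>The operator \<open>v v^*\<close>, left unnormalised: the orthogonal projection onto the
  line of a nonzero \<open>v\<close>, scaled by the squared norm of \<open>v\<close>.\<close>

definition outer_vec :: "complex^'n \<Rightarrow> complex^'n^'n" where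
  "outer_vec v = (\<chi> i j. v $ i * cnj (v $ j))"

text \<open>A vector \<open>v\<close> of the tensor product is read as the matrix with entries \<open>v $ (a, b)\<close>.\<close>

definition col_vec :: "complex^('d \<times> 'd) \<Rightarrow> 'd \<Rightarrow> complex^'d" where
  "col_vec v b = (\<chi> a. v $ (a, b))"

lemma sum_UNIV_prod: "(\<Sum>p\<in>UNIV. f p) = (\<Sum>a\<in>UNIV. \<Sum>b\<in>UNIV. f (a :: 'a::finite, b :: 'b::finite))"
  by (simp add: sum.cartesian_product flip: UNIV_Times_UNIV)

lemma norm_sq_col_vec: "(norm v)\<^sup>2 = (\<Sum>b\<in>UNIV. (norm (col_vec v (b :: 'd::finite)))\<^sup>2)"
proof -
  have "(norm v)\<^sup>2 = (\<Sum>a\<in>UNIV. \<Sum>b\<in>UNIV. (norm (v $ (a, b)))\<^sup>2)"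
    by (simp add: norm_vec_def L2_set_def sum_nonneg real_sqrt_pow2 sum_UNIV_prod)
  also have "\<dots> = (\<Sum>b\<in>UNIV. \<Sum>a\<in>UNIV. (norm (v $ (a, b)))\<^sup>2)"
    by (rule sum.swap)
  finally show ?thesis
    by (simp add: norm_vec_def L2_set_def sum_nonneg real_sqrt_pow2 col_vec_def)
qed

text \<open>With \<open>G b d\<close> the inner product of column \<open>b\<close> of
  \<open>w\<close> and column \<open>d\<close> of \<open>v\<close>, the value is the Hilbert-Schmidt
  inner product of \<open>G\<close> with its transpose, so it can be bounded column by
  column.\<close>

lemma cinner_vec_partial_transpose_outer:
  fixes v w :: "complex^('d::finite \<times> 'd)"
  shows "cinner_vec w (partial_transpose (outer_vec v) *v w) =
    (\<Sum>b\<in>UNIV. \<Sum>d\<in>UNIV. cinner_vec (col_vec w b) (col_vec v d) *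
       cnj (cinner_vec (col_vec w d) (col_vec v b)))"
proof -
  have "cinner_vec w (partial_transpose (outer_vec v) *v w) =
    (\<Sum>a\<in>UNIV. \<Sum>b\<in>UNIV. \<Sum>c\<in>UNIV. \<Sum>d\<in>UNIV.
       cnj (w $ (a, b)) * v $ (a, d) * (w $ (c, d) * cnj (v $ (c, b))))"
    by (simp add: cinner_vec_def matrix_vector_mult_def partial_transpose_def outer_vec_def
        sum_UNIV_prod sum_distrib_left mult_ac)
  \<comment> \<open>Moving the first-factor indices \<open>a\<close> and \<open>c\<close> innermost
    lets them form the inner products of columns.\<close>
  also have "\<dots> = (\<Sum>b\<in>UNIV. \<Sum>a\<in>UNIV. \<Sum>d\<in>UNIV. \<Sum>c\<in>UNIV.
       cnj (w $ (a, b)) * v $ (a, d) * (w $ (c, d) * cnj (v $ (c, b))))"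
    by (rule trans[OF sum.swap], rule sum.cong[OF refl], rule sum.cong[OF refl], rule sum.swap)
  also have "\<dots> = (\<Sum>b\<in>UNIV. \<Sum>d\<in>UNIV. \<Sum>a\<in>UNIV. \<Sum>c\<in>UNIV.
       cnj (w $ (a, b)) * v $ (a, d) * (w $ (c, d) * cnj (v $ (c, b))))"
    by (rule sum.cong[OF refl], rule sum.swap)
  finally show ?thesis
    by (simp add: cinner_vec_def col_vec_def sum_product)
qed

text \<open>A nonvanishing 2-by-2 minor of the matrix of \<open>v\<close> says that \<open>v\<close> is entangled.\<close>

lemma partial_transpose_outer_less:
  fixes v w :: "complex^('d::finite \<times> 'd)"
  assumes minor: "v $ (i, i) * v $ (j, j) \<noteq> v $ (i, j) * v $ (j, i)" and "w \<noteq> 0"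
  shows "w \<bullet> (partial_transpose (outer_vec v) *v w) < (norm w)\<^sup>2 * (norm v)\<^sup>2"
proof -
  \<comment> \<open>\<open>N\<close> is the Cauchy-Schwarz bound for \<open>M\<close>, and its
    squares sum to the right-hand side of the claim.\<close>
  define M where "M b d = norm (cinner_vec (col_vec w b) (col_vec v d))" for b d
  define N where "N b d = norm (col_vec w b) * norm (col_vec v d)" for b d
  have M_le: "(M b d)\<^sup>2 \<le> (N b d)\<^sup>2" for b d
    unfolding M_def N_def by (intro power_mono norm_cinner_vec_le) auto
  have "w \<bullet> (partial_transpose (outer_vec v) *v w) =
    (\<Sum>b\<in>UNIV. \<Sum>d\<in>UNIV. Re (cinner_vec (col_vec w b) (col_vec v d) *
       cnj (cinner_vec (col_vec w d) (col_vec v b))))"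
    unfolding Re_cinner_vec[symmetric] cinner_vec_partial_transpose_outer by simp
  \<comment> \<open>The arithmetic-geometric mean inequality separates \<open>M b d\<close> from its
    transpose \<open>M d b\<close>; both have the same sum of squares.\<close>
  also have "\<dots> \<le> (\<Sum>b\<in>UNIV. \<Sum>d\<in>UNIV. ((M b d)\<^sup>2 + (M d b)\<^sup>2) / 2)"
  proof (intro sum_mono)
    fix b d
    have "Re (cinner_vec (col_vec w b) (col_vec v d) *
        cnj (cinner_vec (col_vec w d) (col_vec v b))) \<le> M b d * M d b"
      unfolding M_def by (rule order_trans[OF complex_Re_le_cmod]) (simp add: norm_mult)
    also have "\<dots> \<le> ((M b d)\<^sup>2 + (M d b)\<^sup>2) / 2"
      using sum_squares_bound[of "M b d" "M d b"] by simp
    finally show "Re (cinner_vec (col_vec w b) (col_vec v d) *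
        cnj (cinner_vec (col_vec w d) (col_vec v b))) \<le> ((M b d)\<^sup>2 + (M d b)\<^sup>2) / 2" .
  qed
  also have "\<dots> = (\<Sum>b\<in>UNIV. \<Sum>d\<in>UNIV. (M b d)\<^sup>2)"
    using sum.swap[of "\<lambda>b d. (M b d)\<^sup>2" UNIV UNIV]
    by (simp add: add_divide_distrib sum.distrib flip: sum_divide_distrib)
  also have "\<dots> < (\<Sum>b\<in>UNIV. \<Sum>d\<in>UNIV. (N b d)\<^sup>2)"
  proof -
    have "\<exists>b. col_vec w b \<noteq> 0"
      using \<open>w \<noteq> 0\<close> by (auto simp: col_vec_def vec_eq_iff)
    then obtain b where b: "col_vec w b \<noteq> 0" ..
    \<comment> \<open>If every column of \<open>v\<close> were parallel to a fixed nonzero column of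
      \<open>w\<close>, the matrix of \<open>v\<close> would have rank at most one, against the
      nonzero minor.\<close>
    have "\<exists>d. \<exists>k l. col_vec w b $ k * col_vec v d $ l \<noteq> col_vec w b $ l * col_vec v d $ k"
    proof (rule ccontr)
      assume "\<not> ?thesis"
      then have par: "w $ (k, b) * v $ (l, d) = w $ (l, b) * v $ (k, d)" for k l d
        by (auto simp: col_vec_def)
      obtain k where k: "w $ (k, b) \<noteq> 0"
        using b by (auto simp: col_vec_def vec_eq_iff)
      \<comment> \<open>Both sides turn into the product of \<open>w $ (i, b)\<close>,
        \<open>w $ (j, b)\<close>, \<open>v $ (k, i)\<close> and \<open>v $ (k, j)\<close>.\<close>
      have "(w $ (k, b) * v $ (i, i)) * (w $ (k, b) * v $ (j, j)) =
          (w $ (k, b) * v $ (i, j)) * (w $ (k, b) * v $ (j, i))"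
        unfolding par[of k i i] par[of k j j] par[of k i j] par[of k j i] by (simp only: mult_ac)
      then have "(w $ (k, b))\<^sup>2 * (v $ (i, i) * v $ (j, j) - v $ (i, j) * v $ (j, i)) = 0"
        by (simp add: algebra_simps power2_eq_square)
      then show False using k minor by simp
    qed
    then obtain d k l where
      "col_vec w b $ k * col_vec v d $ l \<noteq> col_vec w b $ l * col_vec v d $ k" by blast
    then have strict: "(M b d)\<^sup>2 < (N b d)\<^sup>2"
      unfolding M_def N_def by (intro power_strict_mono norm_cinner_vec_less) auto
    have "(\<Sum>p\<in>UNIV. (M (fst p) (snd p))\<^sup>2) < (\<Sum>p\<in>UNIV. (N (fst p) (snd p))\<^sup>2)"
      using strict M_le by (intro sum_strict_mono_ex1) auto
    then show ?thesis by (simp add: sum_UNIV_prod)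
  qed
  also have "\<dots> = (norm w)\<^sup>2 * (norm v)\<^sup>2"
    unfolding N_def norm_sq_col_vec[of w] norm_sq_col_vec[of v] sum_product
    by (simp add: power_mult_distrib)
  finally show ?thesis .
qed

text \<open>Along a line through \<open>v0\<close> the form stays nonzero for small \<open>t\<close>
  by continuity, while the minor is a nonzero polynomial in \<open>t\<close> and vanishes only
  finitely often.\<close>

lemma entangled_qform_nonzero:
  fixes B :: "('d::finite) bipartite_op"
  assumes "v0 \<bullet> (B *v v0) \<noteq> 0" and "i \<noteq> j"
  obtains v where "v \<bullet> (B *v v) \<noteq> 0" "v $ (i, i) * v $ (j, j) \<noteq> v $ (i, j) * v $ (j, i)"
proof -
  \<comment> \<open>This direction has minor 1, so the minor along the line is a monic quadratic
    whatever \<open>v0\<close> is.\<close>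
  define e :: "complex^('d \<times> 'd)" where "e = axis (i, i) 1 + axis (j, j) 1"
  define x where "x t = v0 + t *\<^sub>R e" for t :: real
  define h where "h t = x t \<bullet> (B *v x t)" for t
  have "continuous_on UNIV h"
    unfolding h_def x_def by (intro continuous_intros)
  then have "open {t. h t \<noteq> 0}"
    by (intro open_Collect_neq continuous_intros)
  moreover have "0 \<in> {t. h t \<noteq> 0}" using assms(1) by (simp add: h_def x_def)
  ultimately obtain r where r: "r > 0" "\<And>t. \<bar>t\<bar> < r \<Longrightarrow> h t \<noteq> 0"
    by (auto simp: open_dist dist_real_def)
  define P where "P = [: v0 $ (i, i) * v0 $ (j, j) - v0 $ (i, j) * v0 $ (j, i),
      v0 $ (i, i) + v0 $ (j, j), 1 :]"
  have "finite (complex_of_real -` {z. poly P z = 0})"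
    by (rule finite_vimageI[OF poly_roots_finite inj_of_real]) (simp add: P_def)
  moreover have "infinite {0<..<r}" using r(1) by simp
  ultimately have "\<not> {0<..<r} \<subseteq> complex_of_real -` {z. poly P z = 0}"
    using finite_subset by blast
  then obtain t where t: "t \<in> {0<..<r}" "t \<notin> complex_of_real -` {z. poly P z = 0}"
    by blast
  have "x t $ (i, i) * x t $ (j, j) - x t $ (i, j) * x t $ (j, i) = poly P (complex_of_real t)"
    using assms(2)
    by (simp add: x_def e_def axis_def P_def scaleR_conv_of_real[where 'a = complex] algebra_simps)
  then have "x t $ (i, i) * x t $ (j, j) \<noteq> x t $ (i, j) * x t $ (j, i)"
    using t(2) by auto
  moreover have "x t \<bullet> (B *v x t) \<noteq> 0"
    using t(1) r(2)[of t] by (simp add: h_def)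
  ultimately show thesis using that by blast
qed

section \<open>Crossing the boundary of the PPT states\<close>

lemma partial_transpose_scaleR: "partial_transpose (r *\<^sub>R X) = r *\<^sub>R partial_transpose X"
  by (simp add: partial_transpose_def vec_eq_iff)

lemma partial_transpose_diff: "partial_transpose (X - Y) = partial_transpose X - partial_transpose Y"
  by (simp add: partial_transpose_def vec_eq_iff)

lemma partial_transpose_one: "partial_transpose (mat 1) = mat 1"
  by (auto simp: partial_transpose_def mat_def vec_eq_iff prod_eq_iff)

lemma partial_transpose_involution: "partial_transpose (partial_transpose X) = X"
  by (simp add: partial_transpose_def vec_eq_iff)

lemma trace_partial_transpose: "trace (partial_transpose X) = trace X"
  by (simp add: partial_transpose_def trace_def)

lemma hermitian_mat_partial_transpose:
  "hermitian_mat X \<Longrightarrow> hermitian_mat (partial_transpose X)"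
  by (simp add: hermitian_mat_iff partial_transpose_def)

lemma hermitian_mat_outer_vec: "hermitian_mat (outer_vec v)"
  by (simp add: hermitian_mat_iff outer_vec_def)

lemma outer_vec_mult: "outer_vec v *v w = cinner_vec v w *s v"
  by (simp add: outer_vec_def cinner_vec_def matrix_vector_mult_def vec_eq_iff
      sum_distrib_right sum_distrib_left mult_ac)

lemma sum_norm_sq: "(\<Sum>i\<in>UNIV. v $ i * cnj (v $ i)) = complex_of_real ((norm (v :: complex^'n))\<^sup>2)"
  by (simp add: norm_vec_def L2_set_def sum_nonneg real_sqrt_pow2 complex_norm_square
      del: of_real_power)

lemma qform_outer_vec: "w \<bullet> (outer_vec v *v w) = (norm (cinner_vec v w))\<^sup>2"
proof -
  have "cinner_vec w v = cnj (cinner_vec v w)"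
    by (simp add: cinner_vec_def mult.commute)
  moreover have "cinner_vec w (c *s v) = c * cinner_vec w v" for c
    by (simp add: cinner_vec_def sum_distrib_left mult_ac)
  ultimately have "cinner_vec w (outer_vec v *v w) = cinner_vec v w * cnj (cinner_vec v w)"
    by (simp add: outer_vec_mult)
  then show ?thesis
    unfolding Re_cinner_vec[symmetric] by (simp flip: complex_norm_square)
qed

lemma trace_outer_vec: "trace (outer_vec v) = complex_of_real ((norm v)\<^sup>2)"
  unfolding sum_norm_sq[symmetric] by (simp add: trace_def outer_vec_def)

lemma trace_scaleR: "trace (r *\<^sub>R (A :: complex^'n^'n)) = r *\<^sub>R trace A"
  by (simp add: trace_def scaleR_sum_right)

lemma matrix_mult_scaleR_left: "(r *\<^sub>R (A :: complex^'n^'m)) ** (B :: complex^'k^'n) = r *\<^sub>R (A ** B)"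
  by (simp add: vec_eq_iff matrix_matrix_mult_def scaleR_sum_right)

lemma matrix_add_rdistrib: "((A :: complex^'n^'m) + B) ** (C :: complex^'k^'n) = A ** C + B ** C"
  by (simp add: vec_eq_iff matrix_matrix_mult_def distrib_right sum.distrib)

lemma trace_mult_sum:
  "trace ((D :: complex^'n^'n) ** (\<Sum>j\<in>J. E j)) = (\<Sum>j\<in>J. trace (D ** E j))"
  by (induction J rule: infinite_finite_induct)
    (simp_all add: matrix_add_ldistrib trace_add trace_0[simplified])

text \<open>The state \<rho> is positive definite, while its partial transpose lies on the boundary
  of the positive semidefinite cone. Vanishing trace of \<Delta> keeps the perturbed operators
  normalised.\<close>

lemma ppt_npt_crossing:
  fixes \<Delta> :: "('d::finite) bipartite_op"
  assumes card: "CARD('d) \<ge> 2" and herm: "hermitian_mat \<Delta>" and nz: "\<Delta> \<noteq> 0"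
    and traceless: "trace \<Delta> = 0"
  obtains \<rho> s where "state \<rho>" "ppt \<rho>" "state (\<rho> + s *\<^sub>R \<Delta>)" "npt (\<rho> + s *\<^sub>R \<Delta>)"
proof -
  define B where "B = partial_transpose \<Delta>"
  have B: "hermitian_mat B" unfolding B_def by (rule hermitian_mat_partial_transpose[OF herm])
  have "B \<noteq> 0"
    using nz partial_transpose_involution[of \<Delta>]
    by (auto simp: B_def partial_transpose_def vec_eq_iff)
  with B obtain v0 where v0: "v0 \<bullet> (B *v v0) \<noteq> 0" by (rule hermitian_mat_qform_nonzero)
  obtain i j :: 'd where "i \<noteq> j"
    using card by (metis card_2_iff' ex_card)
  with v0 obtain v where Bv: "v \<bullet> (B *v v) \<noteq> 0"
    and minor: "v $ (i, i) * v $ (j, j) \<noteq> v $ (i, j) * v $ (j, i)"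
    by (rule entangled_qform_nonzero)
  have "v \<noteq> 0" using Bv by auto
  define n where "n = real (CARD('d \<times> 'd))"
  have "CARD('d) * CARD('d) \<ge> 2 * 2" using card by (intro mult_le_mono)
  then have "n > 1" by (simp add: n_def flip: of_nat_mult)
  \<comment> \<open>Normalisation: the operator scaled by \<open>r\<close> below has trace
    \<open>(n - 1) * (norm v)\<^sup>2\<close>, where \<open>n\<close> is the dimension of the whole
    space.\<close>
  define r where "r = 1 / ((n - 1) * (norm v)\<^sup>2)"
  have "r > 0" using \<open>n > 1\<close> \<open>v \<noteq> 0\<close> by (simp add: r_def)
  \<comment> \<open>The partial transpose is fixed first and \<rho> recovered from it, as partial
    transposition is an involution.\<close>
  define \<sigma> where "\<sigma> = r *\<^sub>R ((norm v)\<^sup>2 *\<^sub>R mat 1 - outer_vec v)"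
  define \<rho> where "\<rho> = partial_transpose \<sigma>"
  have \<sigma>: "\<sigma> = partial_transpose \<rho>"
    by (simp add: \<rho>_def partial_transpose_involution)
  have \<rho>_eq: "\<rho> = r *\<^sub>R ((norm v)\<^sup>2 *\<^sub>R mat 1 - partial_transpose (outer_vec v))"
    by (simp add: \<rho>_def \<sigma>_def partial_transpose_scaleR partial_transpose_diff
        partial_transpose_one)
  have herm_\<sigma>: "hermitian_mat \<sigma>" unfolding \<sigma>_def
    by (intro hermitian_mat_scaleR hermitian_mat_diff hermitian_mat_one hermitian_mat_outer_vec)
  have qform_\<sigma>: "w \<bullet> (\<sigma> *v w) = r * ((norm v)\<^sup>2 * (norm w)\<^sup>2 - (norm (cinner_vec v w))\<^sup>2)" for w
    by (simp add: \<sigma>_def matrix_vector_mult_scaleR_left matrix_vector_mult_diff_rdistrib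
        inner_diff_right qform_outer_vec power2_norm_eq_inner)
  have "0 \<le> w \<bullet> (\<sigma> *v w)" for w
    using \<open>r > 0\<close> power_mono[OF norm_cinner_vec_le[of v w], of 2]
    by (simp add: qform_\<sigma> power_mult_distrib)
  with herm_\<sigma> have "psd_mat \<sigma>" by (simp add: psd_mat_iff)
  then have "ppt \<rho>" by (simp add: ppt_def flip: \<sigma>)
  have "cinner_vec v v = complex_of_real ((norm v)\<^sup>2)"
    unfolding sum_norm_sq[symmetric] by (simp add: cinner_vec_def mult.commute)
  then have kernel: "v \<bullet> (\<sigma> *v v) = 0"
    by (simp add: qform_\<sigma> norm_mult power2_eq_square)
  have herm_\<rho>: "hermitian_mat \<rho>"
    unfolding \<rho>_def by (rule hermitian_mat_partial_transpose[OF herm_\<sigma>])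
  have "trace \<sigma> = r *\<^sub>R ((norm v)\<^sup>2 *\<^sub>R complex_of_real n - complex_of_real ((norm v)\<^sup>2))"
    by (simp add: \<sigma>_def trace_scaleR trace_sub trace_outer_vec trace_I n_def)
  also have "\<dots> = complex_of_real (r * ((n - 1) * (norm v)\<^sup>2))"
    by (simp add: scaleR_conv_of_real algebra_simps)
  also have "\<dots> = 1" using \<open>n > 1\<close> \<open>v \<noteq> 0\<close> by (simp add: r_def)
  finally have trace_\<rho>: "trace \<rho> = 1" by (simp add: \<rho>_def trace_partial_transpose)
  have "0 < w \<bullet> (\<rho> *v w)" if "w \<noteq> 0" for w
    using partial_transpose_outer_less[OF minor that] \<open>r > 0\<close>
    by (simp add: \<rho>_eq matrix_vector_mult_scaleR_left matrix_vector_mult_diff_rdistrib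
        inner_diff_right power2_norm_eq_inner mult.commute)
  with herm_\<rho> herm obtain e where "e > 0"
    and psd: "\<forall>s. \<bar>s\<bar> \<le> e \<longrightarrow> psd_mat (\<rho> + s *\<^sub>R \<Delta>)"
    by (rule positive_definite_perturb)
  \<comment> \<open>The sign is opposite to that of the form of \<open>B\<close> at
    \<open>v\<close>. Since \<sigma> contributes nothing there, the perturbed partial transpose
    takes a negative value at \<open>v\<close>.\<close>
  define s where "s = - e * sgn (v \<bullet> (B *v v))"
  have "\<bar>s\<bar> \<le> e" using \<open>e > 0\<close> by (simp add: s_def abs_mult sgn_if)
  have state: "state (\<rho> + t *\<^sub>R \<Delta>)" if "\<bar>t\<bar> \<le> e" for t
    using psd that by (simp add: state_def trace_add trace_scaleR trace_\<rho> traceless)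
  have pt: "partial_transpose (\<rho> + s *\<^sub>R \<Delta>) = \<sigma> + s *\<^sub>R B"
    by (simp add: partial_transpose_add partial_transpose_scaleR B_def \<sigma>)
  have "v \<bullet> ((\<sigma> + s *\<^sub>R B) *v v) = s * (v \<bullet> (B *v v))"
    by (simp add: matrix_vector_mult_add_rdistrib matrix_vector_mult_scaleR_left
        inner_add_right kernel)
  also have "\<dots> = - (e * \<bar>v \<bullet> (B *v v)\<bar>)" by (simp add: s_def abs_sgn mult_ac)
  also have "\<dots> < 0" using \<open>e > 0\<close> Bv by simp
  finally have neg: "v \<bullet> ((\<sigma> + s *\<^sub>R B) *v v) < 0" .
  have "hermitian_mat (\<sigma> + s *\<^sub>R B)"
    by (intro hermitian_mat_add hermitian_mat_scaleR herm_\<sigma> B)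
  from this neg obtain c :: real where "c < 0" "eigenvalue_mat (\<sigma> + s *\<^sub>R B) (complex_of_real c)"
    by (rule hermitian_mat_negative_eigenvalue)
  then have "npt (\<rho> + s *\<^sub>R \<Delta>)" unfolding npt_def pt by blast
  moreover have "state \<rho>" using state[of 0] \<open>e > 0\<close> by simp
  ultimately show thesis using that \<open>ppt \<rho>\<close> state[OF \<open>\<bar>s\<bar> \<le> e\<close>] by blast
qed

theorem corollary1:
  fixes J :: "'o set" and E :: "'o \<Rightarrow> ('d::finite) bipartite_op"
  assumes "CARD('d) \<ge> 2"
    and "povm J E"
    and "determines_ppt_npt J E"
  shows "informationally_complete J E"
proof -
  have "\<Delta> = 0" if \<Delta>: "\<Delta> \<in> undetected_perturbations J E" for \<Delta>
  proof (rule ccontr)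
    assume "\<Delta> \<noteq> 0"
    have herm: "hermitian_mat \<Delta>" and undetected: "\<And>j. j \<in> J \<Longrightarrow> trace (\<Delta> ** E j) = 0"
      using \<Delta> by (auto simp: undetected_perturbations_def)
    \<comment> \<open>The effects sum to the identity, so the trace of \<Delta> is a sum of the
      undetected, hence zero, traces.\<close>
    have "trace \<Delta> = trace (\<Delta> ** (\<Sum>j\<in>J. E j))"
      using assms(2) by (simp add: povm_def)
    also have "\<dots> = 0" unfolding trace_mult_sum by (simp add: undetected)
    finally have "trace \<Delta> = 0" .
    with assms(1) herm \<open>\<Delta> \<noteq> 0\<close> obtain \<rho> s
      where "state \<rho>" "ppt \<rho>" "state (\<rho> + s *\<^sub>R \<Delta>)" "npt (\<rho> + s *\<^sub>R \<Delta>)"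
      by (rule ppt_npt_crossing)
    moreover have "outcome_prob E \<rho> j = outcome_prob E (\<rho> + s *\<^sub>R \<Delta>) j" if "j \<in> J" for j
      using undetected[OF that]
      by (simp add: outcome_prob_def matrix_add_rdistrib trace_add matrix_mult_scaleR_left
          trace_scaleR)
    ultimately show False using assms(3) unfolding determines_ppt_npt_def by blast
  qed
  moreover have "0 \<in> undetected_perturbations J E"
    by (simp add: undetected_perturbations_def hermitian_mat_iff trace_def)
  ultimately show ?thesis unfolding informationally_complete_def by blast
qed

end
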